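(* Let $p>2$ be a prime, let $t$ be a positive divisor of $p-1$, let $k$ be an integer with $1<k<p/2$, and let $a\in\mathbb{F}_p^*$. Put $r_0(k)=\left\lfloor \frac{\log(p/2)}{\log k}\right\rfloor$ and $s=s_0(k,t)=\max\left\{s'\in\mathbb{Z}_{\ge 0}~:~\binom{r_0(k)+s'}{s'}\le t\right\}$. Then $$\#\{|x|~:~x\in U(k,t,a)\}\le\Psi(k,p_{s+1}).$$
   Context: $\mathbb{F}_p$ is the field of residues modulo $p$ and $\mathbb{F}_p^*=\mathbb{F}_p\setminus\{0\}$. For $x\in\mathbb{F}_p$ its integer height is $|x|=\min\{|a|~:~a\in\mathbb{Z},\ a\equiv x \pmod p\}$. For $t\mid p-1$, $G$ denotes the unique subgroup of $\mathbb{F}_p^*$ of order $t$, and $aG=\{ag~:~g\in G\}$. Define $U(k,t,a)=\{x\in aG~:~|x|\le k\}$. $\Psi(x,y)$ is the number of positive integers $n\le x$ all of whose prime factors are at most $y$. $p_j$ denotes the $j$-th prime ($p_1=2$). *)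

theory Defs
  imports "HOL-Number_Theory.Residues" "HOL-Library.Infinite_Set"
begin

abbreviation Fp :: "nat \<Rightarrow> int ring" where
  "Fp p \<equiv> residue_ring (int p)"

abbreviation Fp_star :: "nat \<Rightarrow> int monoid" where
  "Fp_star p \<equiv> mult_of (Fp p)"

definition height :: "nat \<Rightarrow> int \<Rightarrow> nat" where
  "height p x = (LEAST h. \<exists>b::int. [b = x] (mod int p) \<and> h = nat \<bar>b\<bar>)"

text \<open>Well-defined for prime \<open>p\<close> and \<open>t\<close> dividing \<open>p - 1\<close>, see \<open>ex1_subgroup_of_order\<close> below.\<close>

definition subgroup_of_order :: "nat \<Rightarrow> nat \<Rightarrow> int set" where
  "subgroup_of_order p t = (THE G. subgroup G (Fp_star p) \<and> card G = t)"

definition U :: "nat \<Rightarrow> nat \<Rightarrow> nat \<Rightarrow> int \<Rightarrow> int set" where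
  "U p k t a = {x \<in> a <#\<^bsub>Fp_star p\<^esub> subgroup_of_order p t. height p x \<le> k}"

definition smooth_count :: "real \<Rightarrow> real \<Rightarrow> nat" where
  "smooth_count x y =
     card {n::nat. 0 < n \<and> real n \<le> x \<and> (\<forall>q \<in> prime_factors n. real q \<le> y)}"

text \<open>Primes are indexed from 1, whereas \<open>enumerate\<close> counts from 0.\<close>

definition nth_prime :: "nat \<Rightarrow> nat" where
  "nth_prime j = enumerate {q::nat. prime q} (j - 1)"

definition r0 :: "nat \<Rightarrow> nat \<Rightarrow> nat" where
  "r0 p k = nat \<lfloor>ln (real p / 2) / ln (real k)\<rfloor>"

definition s0 :: "nat \<Rightarrow> nat \<Rightarrow> nat \<Rightarrow> nat" where
  "s0 p k t = Max {s'. (r0 p k + s') choose s' \<le> t}"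

lemma ex1_subgroup_of_order:
  assumes "prime p" and "t > 0" and "t dvd p - 1"
  shows "\<exists>!G. subgroup G (Fp_star p) \<and> card G = t"
proof -
  interpret residues_prime p "Fp p"
    by (simp add: residues_prime_def assms)
  interpret M: group "Fp_star p"
    by (rule field_mult_group)
  have fin: "finite (carrier (Fp p))"
    by (rule finite)
  have finM: "finite (carrier (Fp_star p))"
    using fin by simp
  have p1: "p > 1"
    using assms(1) prime_gt_1_nat by blast
  have ord: "card (carrier (Fp_star p)) = p - 1"
  proof -
    have "order (Fp p) = p"
      by (simp add: order_def residue_ring_def)
    then show ?thesis
      using order_mult_of[OF fin] by (simp add: order_def)
  qed
  obtain g where g: "g \<in> carrier (Fp_star p)"
    and gen: "carrier (Fp_star p) = {g [^]\<^bsub>Fp p\<^esub> i | i::nat. i \<in> UNIV}"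
    using finite_field_mult_group_has_gen[OF fin] by blast
  have "generate (Fp_star p) {g} = carrier (Fp_star p)"
    using M.generate_pow_on_finite_carrier[OF finM g] gen by (simp add: nat_pow_mult_of)
  then have og: "M.ord g = p - 1"
    using M.generate_pow_card[OF g] ord by simp
  define d where "d = (p - 1) div t"
  have td: "p - 1 = t * d"
    using assms(3) d_def by simp
  have "t * d > 0"
    using td p1 by linarith
  then have d0: "d \<noteq> 0"
    by simp
  have dg: "d dvd M.ord g"
    unfolding og td by (rule dvd_triv_right)
  define b where "b = g [^]\<^bsub>Fp_star p\<^esub> d"
  have b: "b \<in> carrier (Fp_star p)"
    unfolding b_def using g by (rule M.nat_pow_closed)
  have "M.ord b = t"
    unfolding b_def M.ord_pow[OF g dg d0] og td using d0 by simp
  then have ex: "subgroup (generate (Fp_star p) {b}) (Fp_star p) \<and> card (generate (Fp_star p) {b}) = t"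
    using M.generate_is_subgroup[of "{b}"] M.generate_pow_card[OF b] b by simp
  define S where "S = {x \<in> carrier (Fp p). x [^]\<^bsub>Fp p\<^esub> t = \<one>\<^bsub>Fp p\<^esub>}"
  have S: "card S \<le> t" "finite S"
    using num_roots_le_deg[OF fin, of t] assms(2) fin by (auto simp: S_def)
  have "H = S" if H: "subgroup H (Fp_star p)" "card H = t" for H
  proof -
    interpret H: group "Fp_star p\<lparr>carrier := H\<rparr>"
      by (rule M.subgroup_imp_group[OF H(1)])
    have sub: "H \<subseteq> carrier (Fp_star p)"
      using H(1) by (rule subgroup.subset)
    have "H \<subseteq> S"
    proof
      fix x assume x: "x \<in> H"
      have "x [^]\<^bsub>Fp_star p\<lparr>carrier := H\<rparr>\<^esub> t = \<one>\<^bsub>Fp_star p\<lparr>carrier := H\<rparr>\<^esub>"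
        using H.pow_order_eq_1[of x] x H(2) by (simp add: order_def)
      then have "x [^]\<^bsub>Fp_star p\<^esub> t = \<one>\<^bsub>Fp_star p\<^esub>"
        using M.nat_pow_consistent[of x t H] by simp
      then show "x \<in> S"
        using sub x by (auto simp: S_def nat_pow_mult_of)
    qed
    then show ?thesis
      using S H(2) by (intro card_seteq) auto
  qed
  then show ?thesis
    using ex by (intro ex_ex1I) blast+
qed

lemma s0_set_finite_nonempty:
  assumes "1 < k" and "real k < real p / 2" and "t > 0"
  shows "finite {s'. (r0 p k + s') choose s' \<le> t}" and "0 \<in> {s'. (r0 p k + s') choose s' \<le> t}"
proof -
  have "1 \<le> ln (real p / 2) / ln (real k)"
    using assms by simp
  then have r: "1 \<le> r0 p k"
    unfolding r0_def by linarith
  have "s' \<le> t" if "(r0 p k + s') choose s' \<le> t" for s'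
  proof -
    have "Suc s' choose s' \<le> (r0 p k + s') choose s'"
      using r by (intro binomial_right_mono) auto
    then show ?thesis
      using that by simp
  qed
  then have "{s'. (r0 p k + s') choose s' \<le> t} \<subseteq> {..t}"
    by blast
  then show "finite {s'. (r0 p k + s') choose s' \<le> t}"
    by (rule finite_subset) simp
  show "0 \<in> {s'. (r0 p k + s') choose s' \<le> t}"
    using assms by simp
qed

end

theory Submission
  imports Defs "HOL-Library.Function_Algebras"
begin

text \<open>
  Let \<open>H\<close> be the set of heights and \<open>r = r0 p k\<close>. A product of \<open>r\<close> elements of \<open>H\<close> is at most
  \<open>k\<^sup>r \<le> p / 2\<close>, so it is its own height, and it is therefore one of the at most \<open>t\<close> heights of
  elements of the coset \<open>a\<^sup>r G\<close>. If \<open>H\<close> contains \<open>m + 1\<close> multiplicatively independent integers,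
  these alone have \<open>(r + m) choose m\<close> distinct products of length \<open>r\<close>, so \<open>m \<le> s\<close>: the exponent
  vectors of the elements of \<open>H\<close> span a space of dimension at most \<open>s + 1\<close>. Some \<open>s + 1\<close>
  coordinates, i.e. primes, determine all vectors of this space. Dropping the other primes and
  replacing the chosen ones, in increasing order, by the first \<open>s + 1\<close> primes only decreases a
  number, and thus injects \<open>H\<close> into the \<open>p\<^bsub>s+1\<^esub>\<close>-smooth numbers up to \<open>k\<close>.
\<close>

section \<open>Linear algebra\<close>

interpretation funs: vector_space "\<lambda>(c::'a::field) (f::'b \<Rightarrow> 'a) x. c * f x"
  by unfold_locales (auto simp: fun_eq_iff algebra_simps)

definition determining_set :: "'b set \<Rightarrow> ('b \<Rightarrow> 'a) set \<Rightarrow> bool" where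
  "determining_set Q V \<longleftrightarrow> (\<forall>f\<in>V. \<forall>g\<in>V. (\<forall>q\<in>Q. f q = g q) \<longrightarrow> f = g)"

lemma determining_set_mono: "determining_set Q V \<Longrightarrow> Q \<subseteq> Q' \<Longrightarrow> determining_set Q' V"
  unfolding determining_set_def by blast

lemma determining_set_subspace_iff:
  fixes V :: "('b \<Rightarrow> 'a::field) set"
  assumes "funs.subspace V"
  shows "determining_set Q V \<longleftrightarrow> (\<forall>f\<in>V. (\<forall>q\<in>Q. f q = 0) \<longrightarrow> f = 0)"
proof
  assume "determining_set Q V"
  then show "\<forall>f\<in>V. (\<forall>q\<in>Q. f q = 0) \<longrightarrow> f = 0"
    using funs.subspace_0[OF assms] by (auto simp: determining_set_def)
next
  assume kernel: "\<forall>f\<in>V. (\<forall>q\<in>Q. f q = 0) \<longrightarrow> f = 0"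
  have "f = g" if "f \<in> V" "g \<in> V" "\<forall>q\<in>Q. f q = g q" for f g
    using kernel funs.subspace_diff[OF assms that(1,2)] that(3) by auto
  then show "determining_set Q V"
    by (simp add: determining_set_def)
qed

lemma proportional_if_vanish_on_determining_set:
  fixes f g :: "'b \<Rightarrow> 'a::field"
  assumes "determining_set Q (funs.span B)"
    and f: "f \<in> funs.span (insert b B)" "\<forall>q\<in>Q. f q = 0" "f \<noteq> 0"
    and g: "g \<in> funs.span (insert b B)" "\<forall>q\<in>Q. g q = 0"
  shows "\<exists>c. g = (\<lambda>x. c * f x)"
proof -
  have kernel: "h = 0" if "h \<in> funs.span B" "\<forall>q\<in>Q. h q = 0" for h
    using assms(1) that by (simp add: determining_set_subspace_iff)
  obtain c where c: "f - (\<lambda>x. c * b x) \<in> funs.span B"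
    using f(1) funs.span_breakdown_eq by blast
  obtain d where d: "g - (\<lambda>x. d * b x) \<in> funs.span B"
    using g(1) funs.span_breakdown_eq by blast
  have "c \<noteq> 0"
  proof
    assume "c = 0"
    then have "f \<in> funs.span B"
      using c by (simp flip: zero_fun_def)
    then show False
      using kernel f(2,3) by blast
  qed
  then have "g - (\<lambda>x. d / c * f x)
      = (g - (\<lambda>x. d * b x)) - (\<lambda>x. d / c * (f - (\<lambda>x. c * b x)) x)"
    by (auto simp: field_simps)
  also have "\<dots> \<in> funs.span B"
    by (intro funs.span_diff funs.span_scale c d)
  finally have "g - (\<lambda>x. d / c * f x) = 0"
    by (rule kernel) (use f(2) g(2) in auto)
  then show ?thesis
    by (metis eq_iff_diff_eq_0)
qed

lemma determining_set_span_insert: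
  fixes B :: "('b \<Rightarrow> 'a::field) set"
  assumes "determining_set Q (funs.span B)"
  shows "\<exists>q. determining_set (insert q Q) (funs.span (insert b B))"
proof (cases "determining_set Q (funs.span (insert b B))")
  case True
  then show ?thesis
    using determining_set_mono by blast
next
  case False
  then obtain f where f: "f \<in> funs.span (insert b B)" "\<forall>x\<in>Q. f x = 0" "f \<noteq> 0"
    by (auto simp: determining_set_subspace_iff)
  then obtain q where "f q \<noteq> 0"
    by (auto simp: fun_eq_iff)
  have "g = 0" if g: "g \<in> funs.span (insert b B)" "\<forall>x\<in>insert q Q. g x = 0" for g
  proof -
    obtain c where "g = (\<lambda>x. c * f x)"
      using proportional_if_vanish_on_determining_set[OF assms f] g by blast
    moreover from this have "c = 0"
      using g(2) \<open>f q \<noteq> 0\<close> by simp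
    ultimately show "g = 0"
      by (simp add: fun_eq_iff)
  qed
  then show ?thesis
    by (auto simp: determining_set_subspace_iff)
qed

lemma ex_determining_set_span:
  fixes B :: "('b \<Rightarrow> 'a::field) set"
  assumes "finite B"
  shows "\<exists>Q. finite Q \<and> card Q \<le> card B \<and> determining_set Q (funs.span B)"
  using assms
proof (induction B rule: finite_induct)
  case empty
  show ?case
    by (intro exI[of _ "{}"]) (simp add: determining_set_def)
next
  case (insert b B)
  then obtain Q where Q: "finite Q" "card Q \<le> card B" "determining_set Q (funs.span B)"
    by blast
  obtain q where "determining_set (insert q Q) (funs.span (insert b B))"
    using determining_set_span_insert[OF Q(3)] by blast
  moreover have "card (insert q Q) \<le> card (insert b B)"
    using Q insert.hyps by (simp add: card_insert_if)
  ultimately show ?case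
    using Q(1) by (intro exI[of _ "insert q Q"]) simp
qed

lemma (in Modules.module) sum_mset_eq_sum_scale_count:
  assumes "finite A" "set_mset M \<subseteq> A"
  shows "sum_mset M = (\<Sum>x\<in>A. of_nat (count M x) *s x)"
  using assms(2)
proof (induction M)
  case (add y M)
  have "(\<Sum>x\<in>A. of_nat (count (add_mset y M) x) *s x)
      = (\<Sum>x\<in>A. (if x = y then x else 0) + of_nat (count M x) *s x)"
    by (intro sum.cong) (auto simp: scale_left_distrib)
  also have "\<dots> = y + (\<Sum>x\<in>A. of_nat (count M x) *s x)"
    using add.prems assms(1) by (simp add: sum.distrib)
  finally show ?case
    using add by simp
qed simp

lemma (in Modules.module) inj_on_sum_mset_independent:
  assumes "CHAR('a) = 0" "independent B"
  shows "inj_on sum_mset {M. set_mset M \<subseteq> B}"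
proof (rule inj_onI; clarify)
  fix M N
  assume sub: "set_mset M \<subseteq> B" "set_mset N \<subseteq> B" and eq: "sum_mset M = sum_mset N"
  define A where "A = set_mset M \<union> set_mset N"
  have A: "finite A" "A \<subseteq> B" "set_mset M \<subseteq> A" "set_mset N \<subseteq> A"
    using sub by (auto simp: A_def)
  have "(\<Sum>x\<in>A. (of_nat (count M x) - of_nat (count N x)) *s x) = sum_mset M - sum_mset N"
    using A by (simp add: sum_mset_eq_sum_scale_count scale_left_diff_distrib sum_subtractf)
  also have "\<dots> = 0"
    using eq by simp
  finally have "of_nat (count M x) - of_nat (count N x) = (0::'a)" if "x \<in> A" for x
    using independentD[OF assms(2) A(1,2)] that by fast
  then have "count M x = count N x" if "x \<in> A" for x
    using that assms(1) by (simp add: of_nat_eq_iff_cong_CHAR)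
  moreover have "count M x = count N x" if "x \<notin> A" for x
    using that by (simp add: A_def not_in_iff)
  ultimately show "M = N"
    by (metis multiset_eqI)
qed

section \<open>Multiplicative independence and exponent vectors\<close>

definition multiplicatively_independent :: "'a::comm_monoid_mult set \<Rightarrow> bool" where
  "multiplicatively_independent A \<longleftrightarrow> inj_on prod_mset {M. set_mset M \<subseteq> A}"

definition exponent_vector :: "'a::factorial_semiring \<Rightarrow> 'a \<Rightarrow> rat" where
  "exponent_vector n q = of_nat (count (prime_factorization n) q)"

definition prime_factorization_on :: "'a set \<Rightarrow> 'a::factorial_semiring \<Rightarrow> 'a multiset" where
  "prime_factorization_on Q n = {#q \<in># prime_factorization n. q \<in> Q#}"

lemma exponent_vector_eq_iff:
  "exponent_vector m = exponent_vector n \<longleftrightarrow> prime_factorization m = prime_factorization n"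
  by (auto simp: exponent_vector_def fun_eq_iff multiset_eq_iff)

lemma exponent_vector_prod_mset:
  "0 \<notin># M \<Longrightarrow> exponent_vector (prod_mset M) = (\<Sum>x\<in>#M. exponent_vector x)"
  by (induction M) (auto simp: exponent_vector_def prime_factorization_mult fun_eq_iff)

lemma prime_factorization_on_eq_iff:
  "prime_factorization_on Q m = prime_factorization_on Q n \<longleftrightarrow>
    (\<forall>q\<in>Q. exponent_vector m q = exponent_vector n q)"
  by (auto simp: prime_factorization_on_def exponent_vector_def multiset_eq_iff)

lemma prime_factorization_on_Int_primes:
  "prime_factorization_on (Q \<inter> {q. prime q}) n = prime_factorization_on Q n"
  by (auto simp: prime_factorization_on_def intro: filter_mset_cong)

lemma multiplicatively_independent_if_independent_exponent_vectors:
  assumes "0 \<notin> A" "inj_on exponent_vector A" "funs.independent (exponent_vector ` A)"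
  shows "multiplicatively_independent A"
  unfolding multiplicatively_independent_def
proof (rule inj_onI; clarify)
  fix M N
  assume sub: "set_mset M \<subseteq> A" "set_mset N \<subseteq> A" and eq: "prod_mset M = prod_mset N"
  have "0 \<notin># M" "0 \<notin># N"
    using assms(1) sub by auto
  then have "(\<Sum>x\<in>#M. exponent_vector x) = (\<Sum>x\<in>#N. exponent_vector x)"
    using eq by (simp flip: exponent_vector_prod_mset)
  then have "image_mset exponent_vector M = image_mset exponent_vector N"
    by (rule inj_onD[OF funs.inj_on_sum_mset_independent[OF CHAR_eq_0 assms(3)]])
       (use sub in auto)
  then show "M = N"
    using assms(2) sub by (elim multiset.inj_map_strong[rotated]) (metis inj_onD subsetD)
qed

lemma ex_primes_inj_on_prime_factorization_on:
  fixes H :: "nat set"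
  assumes "0 \<notin> H" "finite H"
    and rank: "\<And>A. A \<subseteq> H \<Longrightarrow> multiplicatively_independent A \<Longrightarrow> card A \<le> m"
  obtains Q where "finite Q" "Q \<subseteq> {q. prime q}" "card Q \<le> m" "inj_on (prime_factorization_on Q) H"
proof -
  obtain B where B: "B \<subseteq> exponent_vector ` H" "funs.independent B"
      "exponent_vector ` H \<subseteq> funs.span B"
    using funs.maximal_independent_subset by blast
  obtain A where A: "A \<subseteq> H" "inj_on exponent_vector A" "B = exponent_vector ` A"
    using B(1) unfolding subset_image_inj by blast
  have "multiplicatively_independent A"
    using A B(2) assms(1) by (intro multiplicatively_independent_if_independent_exponent_vectors) auto
  then have "card B \<le> m"
    using rank A by (simp add: card_image)
  moreover have "finite B"
    using B(1) assms(2) finite_surj by blast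
  ultimately obtain Q where Q: "finite Q" "card Q \<le> m" "determining_set Q (funs.span B)"
    using ex_determining_set_span[of B] by force
  have "inj_on (prime_factorization_on Q) H"
  proof (rule inj_onI)
    fix x y
    assume x: "x \<in> H" and y: "y \<in> H" and "prime_factorization_on Q x = prime_factorization_on Q y"
    then have "exponent_vector x = exponent_vector y"
      using Q(3) B(3) unfolding determining_set_def prime_factorization_on_eq_iff by blast
    then have "prime_factorization x = prime_factorization y"
      by (simp only: exponent_vector_eq_iff)
    moreover have "x \<noteq> 0" "y \<noteq> 0"
      using x y assms(1) by metis+
    ultimately show "x = y"
      by (simp add: prime_factorization_unique)
  qed
  then have "inj_on (prime_factorization_on (Q \<inter> {q. prime q})) H"
    by (simp add: inj_on_def prime_factorization_on_Int_primes)
  moreover have "card (Q \<inter> {q. prime q}) \<le> m"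
    using Q(1,2) by (meson card_mono inf_le1 order_trans)
  ultimately show thesis
    using Q(1) by (intro that[of "Q \<inter> {q. prime q}"]) auto
qed

section \<open>Replacing primes by smaller ones\<close>

lemma enumerate_le_enumerate_subset:
  fixes S :: "'a::wellorder set"
  assumes "infinite S" "finite Q" "Q \<subseteq> S" "i < card Q"
  shows "enumerate S i \<le> enumerate Q i"
  using assms(4)
proof (induction i)
  case 0
  then show ?case
    unfolding enumerate_0[of S] using assms(2,3) finite_enumerate_in_set by (blast intro: Least_le)
next
  case (Suc i)
  have "enumerate S i < enumerate Q (Suc i)"
    using Suc assms(2) finite_enumerate_step[of Q i] by (meson Suc_lessD le_less_trans)
  moreover have "enumerate Q (Suc i) \<in> S"
    using Suc.prems assms(2,3) finite_enumerate_in_set by blast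
  ultimately show ?case
    unfolding enumerate_Suc''[OF assms(1)] by (intro Least_le) simp
qed

lemma ex_inj_on_initial_segment_le:
  fixes S :: "'a::wellorder set"
  assumes "infinite S" "finite Q" "Q \<subseteq> S"
  obtains \<phi> where "inj_on \<phi> Q" "\<phi> ` Q \<subseteq> enumerate S ` {..<card Q}" "\<And>q. q \<in> Q \<Longrightarrow> \<phi> q \<le> q"
proof -
  define rank where "rank = the_inv_into {..<card Q} (enumerate Q)"
  have bij_enumerate_Q: "bij_betw (enumerate Q) {..<card Q} Q"
    using assms(2) by (rule finite_bij_enumerate)
  have bij_rank: "bij_betw rank Q {..<card Q}"
    unfolding rank_def using bij_enumerate_Q by (rule bij_betw_the_inv_into)
  have "enumerate Q (rank q) = q" if "q \<in> Q" for q
    unfolding rank_def using bij_enumerate_Q that by (rule f_the_inv_into_f_bij_betw)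
  then have "enumerate S (rank q) \<le> q" if "q \<in> Q" for q
    using enumerate_le_enumerate_subset[OF assms, of "rank q"] that bij_betwE[OF bij_rank] by force
  moreover have "inj_on (enumerate S \<circ> rank) Q"
    using bij_rank inj_enumerate[OF assms(1)]
    by (meson bij_betw_imp_inj_on comp_inj_on inj_on_subset subset_UNIV)
  moreover have "(enumerate S \<circ> rank) ` Q \<subseteq> enumerate S ` {..<card Q}"
    using bij_rank by (simp add: bij_betw_def flip: image_image)
  ultimately show thesis
    by (intro that[of "enumerate S \<circ> rank"]) auto
qed

definition replace_primes :: "(nat \<Rightarrow> nat) \<Rightarrow> nat set \<Rightarrow> nat \<Rightarrow> nat" where
  "replace_primes \<phi> Q n = (\<Prod>q\<in>#prime_factorization_on Q n. \<phi> q)"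

lemma prime_factorization_replace_primes:
  assumes "\<And>q. q \<in> Q \<Longrightarrow> prime (\<phi> q)"
  shows "prime_factorization (replace_primes \<phi> Q n) = image_mset \<phi> (prime_factorization_on Q n)"
  unfolding replace_primes_def using assms
  by (intro prime_factorization_prod_mset_primes) (auto simp: prime_factorization_on_def)

lemma replace_primes_le:
  assumes "n > 0" "\<And>q. q \<in> Q \<Longrightarrow> \<phi> q \<le> q"
  shows "replace_primes \<phi> Q n \<le> n"
proof -
  have "(\<Prod>q\<in>#M. \<phi> q) \<le> prod_mset M" if "set_mset M \<subseteq> Q" for M
    using that by (induction M) (auto intro: mult_le_mono assms(2))
  from this[of "prime_factorization_on Q n"]
  have "replace_primes \<phi> Q n \<le> prod_mset (prime_factorization_on Q n)"
    by (auto simp: replace_primes_def prime_factorization_on_def)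
  also have "prod_mset (prime_factorization_on Q n) dvd prod_mset (prime_factorization n)"
    unfolding prime_factorization_on_def by (intro prod_mset_subset_imp_dvd multiset_filter_subset)
  then have "prod_mset (prime_factorization_on Q n) \<le> n"
    using assms(1) by (simp add: dvd_imp_le)
  finally show ?thesis .
qed

lemma inj_on_replace_primes:
  assumes "inj_on \<phi> Q" "\<And>q. q \<in> Q \<Longrightarrow> prime (\<phi> q)" "inj_on (prime_factorization_on Q) H"
  shows "inj_on (replace_primes \<phi> Q) H"
proof (rule inj_onI)
  fix m n
  assume mn: "m \<in> H" "n \<in> H" "replace_primes \<phi> Q m = replace_primes \<phi> Q n"
  have "image_mset \<phi> (prime_factorization_on Q m) = image_mset \<phi> (prime_factorization_on Q n)"
    using arg_cong[OF mn(3), of prime_factorization]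
    by (simp add: prime_factorization_replace_primes assms(2))
  then have "prime_factorization_on Q m = prime_factorization_on Q n"
    using assms(1)
    by (elim multiset.inj_map_strong[rotated]) (auto simp: prime_factorization_on_def dest: inj_onD)
  then show "m = n"
    using assms(3) mn(1,2) by (auto dest: inj_onD)
qed

definition smooth_numbers :: "real \<Rightarrow> real \<Rightarrow> nat set" where
  "smooth_numbers x y = {n. 0 < n \<and> real n \<le> x \<and> (\<forall>q\<in>prime_factors n. real q \<le> y)}"

lemma smooth_count_eq_card: "smooth_count x y = card (smooth_numbers x y)"
  by (simp add: smooth_count_def smooth_numbers_def)

lemma finite_smooth_numbers: "finite (smooth_numbers x y)"
proof (rule finite_subset)
  show "smooth_numbers x y \<subseteq> {..nat \<lfloor>x\<rfloor>}"
    by (auto simp: smooth_numbers_def le_nat_floor)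
qed simp

lemma card_le_smooth_count:
  assumes "H \<subseteq> {1..k}"
    and "finite Q" "Q \<subseteq> {q. prime q}" "card Q \<le> j"
    and "inj_on (prime_factorization_on Q) H"
  shows "card H \<le> smooth_count (real k) (real (nth_prime j))"
proof -
  obtain \<phi> where \<phi>: "inj_on \<phi> Q" "\<phi> ` Q \<subseteq> enumerate {q. prime q} ` {..<card Q}"
      "\<And>q. q \<in> Q \<Longrightarrow> \<phi> q \<le> q"
    using ex_inj_on_initial_segment_le[OF primes_infinite assms(2,3)] by blast
  have \<phi>_prime: "prime (\<phi> q)" if "q \<in> Q" for q
    using \<phi>(2) that enumerate_in_set[OF primes_infinite] by auto
  have \<phi>_le: "\<phi> q \<le> nth_prime j" if "q \<in> Q" for q
  proof -
    have "\<phi> q \<in> enumerate {q. prime q} ` {..<card Q}"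
      using \<phi>(2) that by (rule subsetD[OF _ imageI])
    then obtain i where "i < card Q" "\<phi> q = enumerate {q. prime q} i"
      by auto
    then show ?thesis
      using assms(4) by (simp add: nth_prime_def primes_infinite)
  qed
  have "replace_primes \<phi> Q n \<in> smooth_numbers (real k) (real (nth_prime j))" if "n \<in> H" for n
  proof -
    have n: "0 < n" "n \<le> k"
      using that assms(1) by auto
    have "0 \<notin> \<phi> ` Q"
      using \<phi>_prime by (metis imageE not_prime_0)
    then have "0 < replace_primes \<phi> Q n"
      by (intro gr0I) (auto simp: replace_primes_def prime_factorization_on_def)
    moreover have "replace_primes \<phi> Q n \<le> k"
      using replace_primes_le[of n Q \<phi>] n \<phi>(3) by (meson le_trans)
    moreover have "prime_factorization (replace_primes \<phi> Q n)
        = image_mset \<phi> (prime_factorization_on Q n)"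
      using \<phi>_prime by (rule prime_factorization_replace_primes)
    then have "prime_factors (replace_primes \<phi> Q n) \<subseteq> \<phi> ` Q"
      by (auto simp: prime_factorization_on_def)
    then have "\<forall>x\<in>prime_factors (replace_primes \<phi> Q n). x \<le> nth_prime j"
      using \<phi>_le by blast
    ultimately show ?thesis
      by (simp add: smooth_numbers_def)
  qed
  then have "replace_primes \<phi> Q ` H \<subseteq> smooth_numbers (real k) (real (nth_prime j))"
    by blast
  moreover have "inj_on (replace_primes \<phi> Q) H"
    using \<phi>(1) \<phi>_prime assms(5) by (rule inj_on_replace_primes)
  ultimately show ?thesis
    unfolding smooth_count_eq_card using finite_smooth_numbers by (intro card_inj_on_le)
qed

theorem card_le_smooth_count_if_multiplicative_rank_le:
  assumes "H \<subseteq> {1..k}"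
    and "\<And>A. A \<subseteq> H \<Longrightarrow> multiplicatively_independent A \<Longrightarrow> card A \<le> j"
  shows "card H \<le> smooth_count (real k) (real (nth_prime j))"
proof -
  have "0 \<notin> H" "finite H"
    using assms(1) by (auto intro: finite_subset)
  then obtain Q where "finite Q" "Q \<subseteq> {q. prime q}" "card Q \<le> j"
      "inj_on (prime_factorization_on Q) H"
    using ex_primes_inj_on_prime_factorization_on assms(2) by blast
  with assms(1) show ?thesis
    by (rule card_le_smooth_count)
qed

section \<open>Integer heights\<close>

lemma height_le: "[b = x] (mod int m) \<Longrightarrow> height m x \<le> nat \<bar>b\<bar>"
  unfolding height_def by (rule Least_le) blast

lemma height_attained:
  obtains b where "[b = x] (mod int m)" "height m x = nat \<bar>b\<bar>"
proof -
  have "\<exists>b. [b = x] (mod int m) \<and> height m x = nat \<bar>b\<bar>"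
    unfolding height_def by (rule LeastI_ex) (use cong_refl in blast)
  with that show thesis
    by blast
qed

lemma height_cong: "[x = y] (mod int m) \<Longrightarrow> height m x = height m y"
  by (simp add: height_def cong_def)

lemma height_uminus: "height m (- x) = height m x"
proof -
  have "height m (- y) \<le> height m y" for y
  proof -
    obtain b where "[b = y] (mod int m)" "height m y = nat \<bar>b\<bar>"
      by (rule height_attained)
    then show ?thesis
      using height_le[of "- b" "- y" m] by (simp add: cong_minus_minus_iff)
  qed
  from this[of x] this[of "- x"] show ?thesis
    by simp
qed

lemma height_of_nat:
  assumes "2 * n \<le> m"
  shows "height m (int n) = n"
proof -
  obtain b where b: "[b = int n] (mod int m)" "height m (int n) = nat \<bar>b\<bar>"
    by (rule height_attained)
  have "n \<le> nat \<bar>b\<bar>"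
  proof (rule ccontr)
    assume "\<not> n \<le> nat \<bar>b\<bar>"
    then have "0 < int n - b" "int n - b < int m"
      using assms by linarith+
    moreover have "int m dvd int n - b"
      using b(1) by (simp add: cong_iff_dvd_diff dvd_diff_commute)
    ultimately show False
      using zdvd_not_zless by blast
  qed
  then show ?thesis
    using b(2) height_le[of "int n" "int n" m] by simp
qed

lemma height_cong_cases:
  "[int (height m x) = x] (mod int m) \<or> [int (height m x) = - x] (mod int m)"
proof -
  obtain b where b: "[b = x] (mod int m)" "height m x = nat \<bar>b\<bar>"
    by (rule height_attained)
  then have "int (height m x) = b \<or> int (height m x) = - b"
    by linarith
  then show ?thesis
    using b(1) by (auto simp: cong_minus_minus_iff)
qed

lemma height_eq_0_iff: "height m x = 0 \<longleftrightarrow> [x = 0] (mod int m)"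
proof
  assume "height m x = 0"
  then show "[x = 0] (mod int m)"
    using height_cong_cases[of m x] by (auto simp: cong_iff_dvd_diff)
next
  assume "[x = 0] (mod int m)"
  then show "height m x = 0"
    using height_le[of 0 x m] by (simp add: cong_sym)
qed

lemma height_mult_height: "height m (int (height m x) * y) = height m (x * y)"
  using height_cong_cases[of m x]
proof
  assume "[int (height m x) = x] (mod int m)"
  then show ?thesis
    by (intro height_cong cong_scalar_right)
next
  assume "[int (height m x) = - x] (mod int m)"
  then have "height m (int (height m x) * y) = height m (- x * y)"
    by (intro height_cong cong_scalar_right)
  then show ?thesis
    by (simp add: height_uminus)
qed

lemma height_prod_mset_heights:
  "height m (int (\<Prod>x\<in>#M. height m x)) = height m (prod_mset M)"
proof (induction M)
  case (add x M)
  let ?n = "int (\<Prod>y\<in>#M. height m y)"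
  have "height m (int (\<Prod>y\<in>#add_mset x M. height m y)) = height m (?n * x)"
    by (simp add: height_mult_height mult.commute[of _ x])
  also have "\<dots> = height m (int (height m ?n) * x)"
    by (rule height_mult_height[symmetric])
  also have "\<dots> = height m (prod_mset M * x)"
    by (simp only: add.IH height_mult_height)
  finally show ?case
    by (simp add: mult.commute)
qed simp

section \<open>Products of heights in a coset\<close>

lemma (in comm_group) l_coset_mult_mem:
  assumes "subgroup H G" "a \<in> carrier G" "b \<in> carrier G" "x \<in> a <# H" "y \<in> b <# H"
  shows "x \<otimes> y \<in> (a \<otimes> b) <# H"
proof -
  obtain g h where gh: "g \<in> H" "h \<in> H" "x = a \<otimes> g" "y = b \<otimes> h"
    using assms(4,5) by (auto simp: l_coset_def)
  then have "x \<otimes> y = (a \<otimes> b) \<otimes> (g \<otimes> h)"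
    using assms(1-3) by (simp add: subgroup.mem_carrier m_ac)
  then show ?thesis
    using gh subgroup.m_closed[OF assms(1)] by (auto simp: l_coset_def)
qed

lemma comm_group_Fp_star:
  assumes "prime p"
  shows "comm_group (Fp_star p)"
proof -
  interpret residues_prime p "Fp p"
    by (simp add: residues_prime_def assms)
  show ?thesis
    unfolding mult_of_is_Units by (rule units_comm_group)
qed

lemma prod_mset_mod_mem_l_coset:
  assumes "prime p" "subgroup G (Fp_star p)" "a \<in> carrier (Fp_star p)"
    and "set_mset M \<subseteq> a <#\<^bsub>Fp_star p\<^esub> G"
  shows "prod_mset M mod int p \<in> (a [^]\<^bsub>Fp_star p\<^esub> size M) <#\<^bsub>Fp_star p\<^esub> G"
proof -
  interpret residues_prime p "Fp p"
    by (simp add: residues_prime_def assms)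
  interpret star: comm_group "Fp_star p"
    using assms(1) by (rule comm_group_Fp_star)
  show ?thesis
    using assms(4)
  proof (induction M)
    case empty
    have "\<one>\<^bsub>Fp_star p\<^esub> <#\<^bsub>Fp_star p\<^esub> G = G"
      using subgroup.subset[OF assms(2)] by (rule star.lcos_mult_one)
    then show ?case
      using subgroup.one_closed[OF assms(2)] by (simp add: one_cong)
  next
    case (add x M)
    have "(prod_mset M mod int p) \<otimes>\<^bsub>Fp_star p\<^esub> x
        \<in> (a [^]\<^bsub>Fp_star p\<^esub> size M \<otimes>\<^bsub>Fp_star p\<^esub> a) <#\<^bsub>Fp_star p\<^esub> G"
      using add assms(2,3) by (intro star.l_coset_mult_mem star.nat_pow_closed) auto
    moreover have "(prod_mset M mod int p) \<otimes>\<^bsub>Fp_star p\<^esub> x = prod_mset (add_mset x M) mod int p"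
      by (simp add: res_mult_eq mod_mult_right_eq mult.commute[of _ x])
    ultimately show ?case
      by simp
  qed
qed

lemma prod_mset_multisets_of_heights_subset:
  assumes "prime p" "subgroup G (Fp_star p)" "a \<in> carrier (Fp_star p)"
    and "A \<subseteq> height p ` (a <#\<^bsub>Fp_star p\<^esub> G)" "A \<subseteq> {..k}" "2 * k ^ r \<le> p"
  shows "prod_mset ` multisets_of_size A r
    \<subseteq> height p ` ((a [^]\<^bsub>Fp_star p\<^esub> r) <#\<^bsub>Fp_star p\<^esub> G)"
proof clarify
  fix M
  assume "M \<in> multisets_of_size A r"
  then have M: "set_mset M \<subseteq> A" "size M = r"
    by (auto simp: multisets_of_size_def)
  define N where "N = image_mset (inv_into (a <#\<^bsub>Fp_star p\<^esub> G) (height p)) M"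
  have "image_mset (height p) N = image_mset (\<lambda>h. h) M"
    unfolding N_def image_mset.compositionality
    using M(1) assms(4) by (intro image_mset_cong) (auto simp: f_inv_into_f)
  then have heights: "image_mset (height p) N = M"
    by simp
  have "prod_mset M \<le> k ^ size M"
    using M(1) assms(5) by (induction M) (auto intro: mult_le_mono)
  then have "prod_mset M = height p (int (prod_mset M))"
    using M(2) assms(6) by (simp add: height_of_nat)
  also have "\<dots> = height p (prod_mset N mod int p)"
    unfolding heights[symmetric] height_prod_mset_heights by (rule height_cong) (simp add: cong_def)
  finally have "prod_mset M = height p (prod_mset N mod int p)" .
  moreover have "set_mset N \<subseteq> a <#\<^bsub>Fp_star p\<^esub> G"
    unfolding N_def using M(1) assms(4) by (auto intro: inv_into_into)
  then have "prod_mset N mod int p \<in> (a [^]\<^bsub>Fp_star p\<^esub> r) <#\<^bsub>Fp_star p\<^esub> G"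
    using prod_mset_mod_mem_l_coset[OF assms(1-3)] M(2) by (metis N_def size_image_mset)
  ultimately show "prod_mset M \<in> height p ` ((a [^]\<^bsub>Fp_star p\<^esub> r) <#\<^bsub>Fp_star p\<^esub> G)"
    by blast
qed

lemma multichoose_le_card_subgroup:
  assumes "prime p" "subgroup G (Fp_star p)" "finite G" "a \<in> carrier (Fp_star p)"
    and "A \<subseteq> height p ` (a <#\<^bsub>Fp_star p\<^esub> G)" "A \<subseteq> {..k}" "2 * k ^ r \<le> p"
    and "multiplicatively_independent A"
  shows "(card A + r - 1) choose r \<le> card G"
proof -
  let ?coset = "(a [^]\<^bsub>Fp_star p\<^esub> r) <#\<^bsub>Fp_star p\<^esub> G"
  have coset: "?coset = (\<lambda>g. a [^]\<^bsub>Fp_star p\<^esub> r \<otimes>\<^bsub>Fp_star p\<^esub> g) ` G"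
    by (auto simp: l_coset_def)
  have "inj_on prod_mset (multisets_of_size A r)"
    using assms(8) unfolding multiplicatively_independent_def
    by (rule inj_on_subset) (auto simp: multisets_of_size_def)
  moreover have "finite A"
    using assms(6) by (rule finite_subset) simp
  ultimately have "(card A + r - 1) choose r = card (prod_mset ` multisets_of_size A r)"
    by (simp add: card_image card_multisets_of_size)
  also have "\<dots> \<le> card (height p ` ?coset)"
    using prod_mset_multisets_of_heights_subset[OF assms(1,2,4-7)] assms(3)
    by (intro card_mono) (auto simp: coset)
  also have "\<dots> \<le> card G"
    unfolding coset image_image using assms(3) by (rule card_image_le)
  finally show ?thesis .
qed

section \<open>Heights in the truncated coset\<close>

lemma subgroup_of_order:
  assumes "prime p" "t > 0" "t dvd p - 1"
  shows "subgroup (subgroup_of_order p t) (Fp_star p)" "card (subgroup_of_order p t) = t"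
  using theI'[OF ex1_subgroup_of_order[OF assms]] by (auto simp: subgroup_of_order_def)

lemma heights_U_subset:
  assumes "prime p" "t > 0" "t dvd p - 1" "a \<in> carrier (Fp_star p)"
  shows "height p ` U p k t a \<subseteq> {1..k}"
proof clarify
  fix x
  assume x: "x \<in> U p k t a"
  interpret residues_prime p "Fp p"
    by (simp add: residues_prime_def assms)
  have "x \<in> carrier (Fp_star p)"
    using x assms(4) subgroup_of_order(1)[OF assms(1-3)] group.l_coset_carrier[OF field_mult_group]
    by (auto simp: U_def)
  then have "\<not> [x = 0] (mod int p)"
    by (auto simp: res_carrier_eq res_zero_eq cong_def)
  then have "height p x \<noteq> 0"
    by (simp add: height_eq_0_iff)
  with x show "height p x \<in> {1..k}"
    by (simp add: U_def)
qed

lemma power_r0_le: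
  assumes "1 < k" "real k < real p / 2"
  shows "2 * k ^ r0 p k \<le> p"
proof -
  have "0 \<le> ln (real p / 2) / ln (real k)"
    using assms by simp
  then have "real (r0 p k) \<le> ln (real p / 2) / ln (real k)"
    unfolding r0_def by (simp add: of_nat_floor)
  then have "ln (real k ^ r0 p k) \<le> ln (real p / 2)"
    using assms(1) by (simp add: ln_realpow field_simps)
  then have "real k ^ r0 p k \<le> real p / 2"
    using assms by (subst (asm) ln_le_cancel_iff) auto
  then have "real (2 * k ^ r0 p k) \<le> real p"
    by simp
  then show ?thesis
    by (simp only: of_nat_le_iff)
qed

lemma card_multiplicatively_independent_heights_le:
  assumes "prime p" "t > 0" "t dvd p - 1" "1 < k" "real k < real p / 2" "a \<in> carrier (Fp_star p)"
    and "A \<subseteq> height p ` U p k t a" "multiplicatively_independent A"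
  shows "card A \<le> s0 p k t + 1"
proof (cases "card A")
  case (Suc m)
  let ?G = "subgroup_of_order p t"
  have G: "subgroup ?G (Fp_star p)" "card ?G = t"
    using assms(1-3) by (rule subgroup_of_order)+
  have "finite ?G"
    using G(2) assms(2) by (intro card_ge_0_finite) simp
  have heights: "A \<subseteq> height p ` (a <#\<^bsub>Fp_star p\<^esub> ?G)" "A \<subseteq> {..k}"
    using assms(7) by (auto simp: U_def)
  have "2 * k ^ r0 p k \<le> p"
    using assms(4,5) by (rule power_r0_le)
  then have "(card A + r0 p k - 1) choose r0 p k \<le> t"
    using multichoose_le_card_subgroup[OF assms(1) G(1) \<open>finite ?G\<close> assms(6) heights _ assms(8)] G(2)
    by simp
  then have "(r0 p k + m) choose m \<le> t"
    using Suc binomial_symmetric[of m "r0 p k + m"] by (simp add: add.commute)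
  then have "m \<le> s0 p k t"
    unfolding s0_def using s0_set_finite_nonempty(1)[OF assms(4,5,2)] by (intro Max_ge) auto
  then show ?thesis
    using Suc by simp
qed simp

theorem theorem1p1:
  fixes p t k s :: nat and a :: int
  assumes "prime p" and "p > 2"
    and "t > 0" and "t dvd p - 1"
    and "1 < k" and "real k < real p / 2"
    and "a \<in> carrier (Fp_star p)"
    and "s = s0 p k t"
  shows "card (height p ` U p k t a) \<le> smooth_count (real k) (real (nth_prime (s + 1)))"
proof (rule card_le_smooth_count_if_multiplicative_rank_le)
  show "height p ` U p k t a \<subseteq> {1..k}"
    using assms by (intro heights_U_subset)
  show "card A \<le> s + 1"
    if "A \<subseteq> height p ` U p k t a" "multiplicatively_independent A" for A
    using card_multiplicatively_independent_heights_le[OF assms(1,3-7) that] assms(8) by simp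
qed

end
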